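(* Let $P$ be a probability distribution on $\mathbb{R}^d$, let $\epsilon>0$, and let $C(\mathbf{x},\mathbf{y})=\|\mathbf{x}-\mathbf{y}\|$ for a general norm $\|\cdot\|$ on $\mathbb{R}^d$. Consider the optimization problem over star bodies $K\subset\mathbb{R}^d$, scalars $s$, and functions $\lambda\in L^1(\mathrm{d}P)$: $$\inf_{K,s,\lambda}\ s\,\epsilon+\int\lambda(\mathbf{x})\,\mathrm{d}P(\mathbf{x})\quad\text{s.t.}\quad sC(\mathbf{x},\mathbf{y})+\lambda(\mathbf{x})\ge\|\mathbf{y}\|_K\ \ \forall\,\mathbf{x},\mathbf{y}\in\mathbb{R}^d,\quad s\ge 0,\quad\mathrm{vol}(K)\le 1 .$$ Suppose that the optimal value of this problem is finite. Then there exists a closed star set $K$ that attains the minimum objective value, i.e. there exist a closed star set $K$, a scalar $s\ge0$ and a function $\lambda\in L^1(\mathrm{d}P)$ satisfying $sC(\mathbf{x},\mathbf{y})+\lambda(\mathbf{x})\ge\|\mathbf{y}\|_K$ for all $\mathbf{x},\mathbf{y}\in\mathbb{R}^d$ and $\mathrm{vol}(K)\le 1$, whose objective value $s\epsilon+\int\lambda\,\mathrm{d}P$ equals the optimal value.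
   Context: A set $K\subset\mathbb{R}^d$ is star if $[\mathbf{0},\mathbf{y}]\subset K$ for every $\mathbf{y}\in K$. A star body is a compact star set with nonempty interior such that for every $\mathbf{x}\ne \mathbf{0}$ the ray $\{\lambda\mathbf{x}:\lambda>0\}$ meets the boundary of $K$ exactly once (equivalently, its radial function $\rho_K(\mathbf{u})=\sup\{\lambda\ge0:\lambda\mathbf{u}\in K\}$ is positive and continuous on the unit sphere). The gauge of $K$ is $\|\mathbf{x}\|_K=\inf\{\lambda\ge 0:\mathbf{x}\in\lambda K\}$. $\mathrm{vol}$ is $d$-dimensional Lebesgue volume. $L^1(\mathrm{d}P)$ is the set of (real-valued, measurable) functions $f$ on $\mathbb{R}^d$ with $\int|f|\,\mathrm{d}P<\infty$. *)

theory Defs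
  imports "HOL-Probability.Probability"
begin

definition is_norm :: "('a::real_vector \<Rightarrow> real) \<Rightarrow> bool" where
  "is_norm N \<longleftrightarrow>
     (\<forall>x. 0 \<le> N x) \<and>
     (\<forall>x. N x = 0 \<longleftrightarrow> x = 0) \<and>
     (\<forall>a x. N (a *\<^sub>R x) = \<bar>a\<bar> * N x) \<and>
     (\<forall>x y. N (x + y) \<le> N x + N y)"

definition star_set :: "'a::real_vector set \<Rightarrow> bool" where
  "star_set K \<longleftrightarrow> (\<forall>y\<in>K. closed_segment 0 y \<subseteq> K)"

definition star_body :: "'a::real_normed_vector set \<Rightarrow> bool" where
  "star_body K \<longleftrightarrow>
     compact K \<and> star_set K \<and> interior K \<noteq> {} \<and>
     (\<forall>x. x \<noteq> 0 \<longrightarrow> (\<exists>!z. z \<in> {l *\<^sub>R x |l. l > 0} \<inter> frontier K))"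

text \<open>
  The gauge is extended-real valued: it is \<open>\<infinity>\<close> at \<open>x\<close> if no dilate of \<open>K\<close> contains \<open>x\<close>
  (the infimum of the empty set), which can happen for a closed star set that is not a star body.
\<close>

definition star_gauge :: "'a::real_vector set \<Rightarrow> 'a \<Rightarrow> ereal" where
  "star_gauge K x = Inf {ereal l |l. l \<ge> 0 \<and> x \<in> (*\<^sub>R) l ` K}"

text \<open>
  All constraints of the optimization problem except for the shape of \<open>K\<close>, which is a star body
  in the problem itself and only a closed star set for the minimizer.
  The volume is taken as an extended nonnegative real because \<open>measure\<close> is \<open>0\<close> on sets of
  infinite volume.
\<close>

definition feasible ::
  "('a::euclidean_space \<Rightarrow> real) \<Rightarrow> 'a measure \<Rightarrow> 'a set \<Rightarrow> real \<Rightarrow> ('a \<Rightarrow> real) \<Rightarrow> bool" where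
  "feasible N P K s lam \<longleftrightarrow>
     integrable P lam \<and>
     (\<forall>x y. ereal (s * N (x - y) + lam x) \<ge> star_gauge K y) \<and>
     s \<ge> 0 \<and> emeasure lborel K \<le> 1"

definition objective :: "'a measure \<Rightarrow> real \<Rightarrow> real \<Rightarrow> ('a \<Rightarrow> real) \<Rightarrow> real" where
  "objective P eps s lam = s * eps + (\<integral>x. lam x \<partial>P)"

definition optimal_value ::
  "('a::euclidean_space \<Rightarrow> real) \<Rightarrow> 'a measure \<Rightarrow> real \<Rightarrow> ereal" where
  "optimal_value N P eps =
     Inf {ereal (objective P eps s lam) |K s lam. star_body K \<and> feasible N P K s lam}"

end

theory Submission
  imports Defs "HOL-Complex_Analysis.Great_Picard"
begin

text \<open>
  For a feasible triple \<open>(K, s, \<lambda>)\<close>, the smallest function dominating the gauge of \<open>K\<close> that is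
  \<open>s\<close>-Lipschitz with respect to the norm is the sup-convolution
  \<open>f x = (\<Squnion>y. \<parallel>y\<parallel>\<^sub>K - s * N (x - y))\<close>. It lies below \<open>\<lambda>\<close> and is again positively homogeneous, hence
  it is the gauge of \<open>{f \<le> 1} \<subseteq> K\<close>. The problem thus becomes one over nonnegative, positively
  homogeneous, \<open>s\<close>-Lipschitz functions \<open>f\<close> with \<open>vol {f < 1} \<le> 1\<close>. Along a minimizing sequence
  the Lipschitz constants are bounded since \<open>eps > 0\<close>, so by Arzela--Ascoli a subsequence
  converges on the unit ball and, by homogeneity, everywhere. Fatou's lemma, applied to the
  integrals and to the indicators of \<open>{f < 1}\<close>, shows that the limit is admissible with objective
  value at most the infimum. Any remaining slack is absorbed by adding a constant to \<open>\<lambda>\<close>.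
\<close>

subsection \<open>Norms and gauges\<close>

lemma is_normD:
  assumes "is_norm N"
  shows is_norm_nonneg: "0 \<le> N x"
    and is_norm_0: "N 0 = 0"
    and is_norm_scaleR: "N (a *\<^sub>R x) = \<bar>a\<bar> * N x"
    and is_norm_triangle: "N (x + y) \<le> N x + N y"
    and is_norm_minus_commute: "N (x - y) = N (y - x)"
proof -
  show "0 \<le> N x" "N 0 = 0" and sc: "N (a *\<^sub>R x) = \<bar>a\<bar> * N x" for a x
    using assms by (auto simp: is_norm_def)
  show "N (x + y) \<le> N x + N y"
    using assms by (auto simp: is_norm_def)
  show "N (x - y) = N (y - x)"
    using sc[of "-1" "y - x"] by simp
qed

lemma is_norm_sum_le:
  assumes "is_norm N" "finite A"
  shows "N (\<Sum>i\<in>A. g i) \<le> (\<Sum>i\<in>A. N (g i))"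
  using assms(2)
proof (induction A rule: finite_induct)
  case (insert a A)
  then show ?case
    using is_norm_triangle[OF assms(1), of "g a" "sum g A"] by simp
qed (simp add: is_norm_0[OF assms(1)])

text \<open>Expand \<open>x\<close> in the orthonormal basis and bound each coordinate by
  \<open>norm x\<close>. The summand 1 in the constant gives \<open>B > 0\<close> at once.\<close>

lemma is_norm_le_norm:
  fixes N :: "'a::euclidean_space \<Rightarrow> real"
  assumes "is_norm N"
  obtains B where "B > 0" "\<And>x. N x \<le> B * norm x"
proof
  let ?B = "1 + (\<Sum>b\<in>Basis. N b)"
  have "(\<Sum>b\<in>Basis. N b) \<ge> 0"
    by (intro sum_nonneg is_norm_nonneg[OF assms])
  then show "?B > 0" by simp
  fix x :: 'a
  have "N x = N (\<Sum>b\<in>Basis. (x \<bullet> b) *\<^sub>R b)"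
    by (simp add: euclidean_representation)
  also have "\<dots> \<le> (\<Sum>b\<in>Basis. N ((x \<bullet> b) *\<^sub>R b))"
    by (intro is_norm_sum_le[OF assms]) simp
  also have "\<dots> = (\<Sum>b\<in>Basis. \<bar>x \<bullet> b\<bar> * N b)"
    by (simp add: is_norm_scaleR[OF assms])
  also have "\<dots> \<le> (\<Sum>b\<in>Basis. norm x * N b)"
    by (intro sum_mono mult_right_mono is_norm_nonneg[OF assms] Basis_le_norm)
  also have "\<dots> \<le> ?B * norm x"
    by (simp add: sum_distrib_left[symmetric] distrib_left mult.commute[of _ "norm x"])
  finally show "N x \<le> ?B * norm x" .
qed

lemma star_gauge_nonneg: "0 \<le> star_gauge K x"
  unfolding star_gauge_def by (intro Inf_greatest) auto

text \<open>The substitution \<open>l\<close> to \<open>l / t\<close> matches the dilation factors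
  admissible for \<open>t *\<^sub>R x\<close> with those for \<open>x\<close>, and infima commute
  with multiplication by a positive real.\<close>

lemma star_gauge_scaleR:
  assumes "t > 0"
  shows "star_gauge K (t *\<^sub>R x) = ereal t * star_gauge K x"
proof -
  have mem: "t *\<^sub>R x \<in> (*\<^sub>R) l ` K \<longleftrightarrow> x \<in> (*\<^sub>R) (l / t) ` K" for l
  proof -
    have "t *\<^sub>R x = l *\<^sub>R k \<longleftrightarrow> x = (l / t) *\<^sub>R k" for k
      using assms by (metis (no_types, opaque_lifting) less_irrefl nonzero_divide_eq_eq
          scaleR_cancel_left scaleR_scaleR mult.commute)
    then show ?thesis by auto
  qed
  have "{ereal l |l. l \<ge> 0 \<and> t *\<^sub>R x \<in> (*\<^sub>R) l ` K} =
      {ereal t * y |y. y \<in> {ereal l |l. l \<ge> 0 \<and> x \<in> (*\<^sub>R) l ` K}}"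
  proof (intro equalityI subsetI)
    fix z assume "z \<in> {ereal l |l. l \<ge> 0 \<and> t *\<^sub>R x \<in> (*\<^sub>R) l ` K}"
    then obtain l where l: "z = ereal l" "l \<ge> 0" "x \<in> (*\<^sub>R) (l / t) ` K"
      unfolding mem by blast
    have "z = ereal t * ereal (l / t)" "l / t \<ge> 0" using l assms by auto
    then show "z \<in> {ereal t * y |y. y \<in> {ereal l |l. l \<ge> 0 \<and> x \<in> (*\<^sub>R) l ` K}}"
      using l(3) by blast
  next
    fix z assume "z \<in> {ereal t * y |y. y \<in> {ereal l |l. l \<ge> 0 \<and> x \<in> (*\<^sub>R) l ` K}}"
    then obtain l where l: "z = ereal (t * l)" "l \<ge> 0" "x \<in> (*\<^sub>R) l ` K"
      by (smt (verit) mem_Collect_eq times_ereal.simps(1))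
    have "t * l \<ge> 0" "t *\<^sub>R x \<in> (*\<^sub>R) (t * l) ` K"
      using l assms by (auto simp: mem)
    then show "z \<in> {ereal l |l. l \<ge> 0 \<and> t *\<^sub>R x \<in> (*\<^sub>R) l ` K}"
      using l(1) by blast
  qed
  then show ?thesis
    using ereal_Inf_cmult[OF assms, of "\<lambda>y. y \<in> {ereal l |l. l \<ge> 0 \<and> x \<in> (*\<^sub>R) l ` K}"]
    unfolding star_gauge_def by simp
qed

text \<open>Strictness yields an admissible factor \<open>l < 1\<close> without asking whether the
  infimum is attained; then \<open>x = l *\<^sub>R k\<close> lies on the segment from 0 to some
  \<open>k\<close> in \<open>K\<close>.\<close>

lemma star_gauge_less_1_imp_mem:
  assumes "star_set K" "star_gauge K x < 1"
  shows "x \<in> K"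
proof -
  obtain l where l: "0 \<le> l" "x \<in> (*\<^sub>R) l ` K" "l < 1"
    using assms(2) unfolding star_gauge_def Inf_less_iff one_ereal_def
    by (smt (verit) ereal_less(3) less_ereal.simps(1) mem_Collect_eq)
  then obtain k where k: "k \<in> K" "x = l *\<^sub>R k" by auto
  then have "x \<in> closed_segment 0 k"
    using l by (auto simp: closed_segment_def intro!: exI[of _ l])
  then show ?thesis using assms(1) k by (auto simp: star_set_def)
qed

subsection \<open>Homogeneous Lipschitz functions\<close>

text \<open>All three conditions pass to pointwise limits of \<open>f\<close> along converging
  \<open>s\<close>. The one-sided Lipschitz bound becomes two-sided by symmetry of \<open>N\<close>,
  and homogeneity for \<open>t > 0\<close> forces the value 0 at the origin.\<close>

definition lipschitz_gauge :: "('a::real_vector \<Rightarrow> real) \<Rightarrow> real \<Rightarrow> ('a \<Rightarrow> real) \<Rightarrow> bool" where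
  "lipschitz_gauge N s f \<longleftrightarrow>
     (\<forall>x. 0 \<le> f x) \<and>
     (\<forall>x y. f x \<le> f y + s * N (x - y)) \<and>
     (\<forall>t>0. \<forall>x. f (t *\<^sub>R x) = t * f x)"

lemma lipschitz_gaugeD:
  assumes "lipschitz_gauge N s f"
  shows lipschitz_gauge_nonneg: "0 \<le> f x"
    and lipschitz_gauge_le: "f x \<le> f y + s * N (x - y)"
    and lipschitz_gauge_scaleR: "t > 0 \<Longrightarrow> f (t *\<^sub>R x) = t * f x"
  using assms by (auto simp: lipschitz_gauge_def)

lemma lipschitz_gauge_zero:
  assumes "lipschitz_gauge N s f"
  shows "f 0 = 0"
  using lipschitz_gauge_scaleR[OF assms, of 2 0] by simp

lemma lipschitz_gauge_dist_le:
  assumes "is_norm N" "lipschitz_gauge N s f" "0 \<le> s" "\<And>x. N x \<le> B * norm x"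
  shows "\<bar>f x - f y\<bar> \<le> s * B * norm (x - y)"
proof -
  have "\<bar>f x - f y\<bar> \<le> s * N (x - y)"
    using lipschitz_gauge_le[OF assms(2), of x y] lipschitz_gauge_le[OF assms(2), of y x]
      is_norm_minus_commute[OF assms(1), of x y] by simp
  also have "\<dots> \<le> s * (B * norm (x - y))"
    by (intro mult_left_mono assms)
  finally show ?thesis by (simp add: mult.assoc)
qed

lemma lipschitz_gauge_continuous:
  fixes f :: "'a::euclidean_space \<Rightarrow> real"
  assumes "is_norm N" "lipschitz_gauge N s f" "0 \<le> s"
  shows "continuous_on UNIV f"
proof -
  obtain B where B: "B > 0" "\<And>x. N x \<le> B * norm x"
    using is_norm_le_norm[OF assms(1)] by blast
  have "(s * B)-lipschitz_on UNIV f"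
    using lipschitz_gauge_dist_le[OF assms B(2)] B(1) assms(3)
    by (intro lipschitz_onI) (auto simp: dist_norm)
  then show ?thesis by (rule lipschitz_on_continuous_on)
qed

text \<open>By homogeneity, a factor \<open>l > 0\<close> is admissible for \<open>y\<close> exactly
  if \<open>f y \<le> l\<close>. Only the factor 0, for which the dilate is at most the origin,
  needs separate care.\<close>

lemma star_gauge_sublevel_set:
  assumes "lipschitz_gauge N s f"
  shows "star_gauge {x. f x \<le> 1} y = ereal (f y)"
proof (rule antisym)
  have mem: "y \<in> (*\<^sub>R) l ` {x. f x \<le> 1} \<longleftrightarrow> f y \<le> l" if "l > 0" for l
  proof
    assume "y \<in> (*\<^sub>R) l ` {x. f x \<le> 1}"
    then show "f y \<le> l"
      using that by (auto simp: lipschitz_gauge_scaleR[OF assms])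
  next
    assume "f y \<le> l"
    then have "f ((1 / l) *\<^sub>R y) \<le> 1"
      using that by (subst lipschitz_gauge_scaleR[OF assms]) auto
    moreover have "y = l *\<^sub>R ((1 / l) *\<^sub>R y)" using that by simp
    ultimately show "y \<in> (*\<^sub>R) l ` {x. f x \<le> 1}" by blast
  qed
  \<comment> \<open>The factor \<open>f y\<close> itself may be 0 at some \<open>y\<close> other
    than the origin and is then not admissible; enlarging it by \<open>e\<close> keeps it
    positive.\<close>
  show "star_gauge {x. f x \<le> 1} y \<le> ereal (f y)"
  proof (rule ereal_le_epsilon2)
    fix e :: real assume "e > 0"
    have pos: "f y + e > 0"
      using lipschitz_gauge_nonneg[OF assms, of y] \<open>e > 0\<close> by linarith
    then have "y \<in> (*\<^sub>R) (f y + e) ` {x. f x \<le> 1}"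
      using mem \<open>e > 0\<close> by simp
    then have "star_gauge {x. f x \<le> 1} y \<le> ereal (f y + e)"
      unfolding star_gauge_def using pos by (intro Inf_lower) auto
    then show "star_gauge {x. f x \<le> 1} y \<le> ereal (f y) + ereal e" by simp
  qed
  show "ereal (f y) \<le> star_gauge {x. f x \<le> 1} y"
    unfolding star_gauge_def
  proof (rule Inf_greatest)
    fix z assume "z \<in> {ereal l |l. l \<ge> 0 \<and> y \<in> (*\<^sub>R) l ` {x. f x \<le> 1}}"
    then obtain l where l: "z = ereal l" "l \<ge> 0" "y \<in> (*\<^sub>R) l ` {x. f x \<le> 1}" by blast
    have "f y \<le> l"
    proof (cases "l = 0")
      case True
      with l(3) have "y = 0" by auto
      then show ?thesis using lipschitz_gauge_zero[OF assms] True by simp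
    next
      case False
      then show ?thesis using mem l by simp
    qed
    then show "ereal (f y) \<le> z" using l(1) by simp
  qed
qed

lemma star_set_sublevel_set:
  assumes "lipschitz_gauge N s f"
  shows "star_set {x. f x \<le> 1}"
  unfolding star_set_def
proof (intro ballI subsetI)
  fix y z assume y: "y \<in> {x. f x \<le> 1}" and "z \<in> closed_segment 0 y"
  then obtain u where u: "0 \<le> u" "u \<le> 1" "z = u *\<^sub>R y"
    by (auto simp: closed_segment_def)
  show "z \<in> {x. f x \<le> 1}"
  proof (cases "u = 0")
    case True
    then show ?thesis using u lipschitz_gauge_zero[OF assms] by simp
  next
    case False
    then have "f z = u * f y" using u lipschitz_gauge_scaleR[OF assms] by simp
    also have "\<dots> \<le> 1"
      using y u lipschitz_gauge_nonneg[OF assms, of y] by (simp add: mult_le_one)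
    finally show ?thesis by simp
  qed
qed

text \<open>For every \<open>t > 1\<close> the closed sublevel set lies in the dilate by
  \<open>t\<close> of the open one, whose volume is at most \<open>t ^ DIM('a)\<close>; now let
  \<open>t\<close> tend to 1. This bridges the open sets, whose volume bound survives limits, and
  the closed star set required of the minimizer.\<close>

lemma emeasure_sublevel_set_le_1:
  fixes f :: "'a::euclidean_space \<Rightarrow> real"
  assumes "is_norm N" "lipschitz_gauge N s f" "0 \<le> s"
    and vol: "emeasure lborel {x. f x < 1} \<le> 1"
  shows "emeasure lborel {x. f x \<le> 1} \<le> 1"
proof -
  note cont = lipschitz_gauge_continuous[OF assms(1-3)]
  have op: "open {x. f x < 1}"
    by (intro open_Collect_less cont continuous_on_const)
  have bound: "emeasure lborel {x. f x \<le> 1} \<le> ennreal (t ^ DIM('a))" if "t > 1" for t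
  proof -
    \<comment> \<open>The summand 0 brings the dilation into the affine form of
      \<open>emeasure_lebesgue_affine\<close>.\<close>
    have sub: "{x. f x \<le> 1} \<subseteq> (\<lambda>x. t *\<^sub>R x + 0) ` {x. f x < 1}"
    proof
      fix x assume x: "x \<in> {x. f x \<le> 1}"
      have "f ((1 / t) *\<^sub>R x) < 1"
        using that x by (subst lipschitz_gauge_scaleR[OF assms(2)]) auto
      moreover have "x = t *\<^sub>R ((1 / t) *\<^sub>R x) + 0" using that by simp
      ultimately show "x \<in> (\<lambda>x. t *\<^sub>R x + 0) ` {x. f x < 1}" by blast
    qed
    have "open ((\<lambda>x. t *\<^sub>R x + 0) ` {x. f x < 1})"
      using open_scaling[of t "{x. f x < 1}"] op that by simp
    then have bor: "(\<lambda>x. t *\<^sub>R x + 0) ` {x. f x < 1} \<in> sets borel" by simp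
    have "emeasure lborel {x. f x \<le> 1} \<le> emeasure lborel ((\<lambda>x. t *\<^sub>R x + 0) ` {x. f x < 1})"
      using sub bor by (intro emeasure_mono) auto
    also have "\<dots> = emeasure lebesgue ((\<lambda>x. t *\<^sub>R x + 0) ` {x. f x < 1})"
      using bor by simp
    also have "\<dots> = ennreal (\<bar>t\<bar> ^ DIM('a)) * emeasure lebesgue {x. f x < 1}"
      by (rule emeasure_lebesgue_affine)
    also have "\<dots> = ennreal (t ^ DIM('a)) * emeasure lborel {x. f x < 1}"
      using op that by simp
    also have "\<dots> \<le> ennreal (t ^ DIM('a)) * 1"
      by (intro mult_left_mono vol) simp
    finally show ?thesis by simp
  qed
  have "((\<lambda>t::real. ennreal (t ^ DIM('a))) \<longlongrightarrow> ennreal (1 ^ DIM('a))) (at_right 1)"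
    by (intro tendsto_intros)
  moreover have "\<forall>\<^sub>F t in at_right (1::real). emeasure lborel {x. f x \<le> 1} \<le> ennreal (t ^ DIM('a))"
    using eventually_at_right_less[of "1::real"] by eventually_elim (rule bound)
  ultimately have "emeasure lborel {x. f x \<le> 1} \<le> ennreal (1 ^ DIM('a))"
    by (intro tendsto_lowerbound) auto
  then show ?thesis by simp
qed

text \<open>The Lipschitz bound together with \<open>f \<le> lam\<close> gives the gauge constraint.
  Keeping \<open>lam\<close> separate from \<open>f\<close> leaves room to add a constant
  later.\<close>

lemma lipschitz_gauge_feasible:
  fixes f :: "'a::euclidean_space \<Rightarrow> real"
  assumes "is_norm N" "lipschitz_gauge N s f" "0 \<le> s" "emeasure lborel {x. f x < 1} \<le> 1"
    and "integrable P lam" "\<And>x. f x \<le> lam x"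
  shows "feasible N P {x. f x \<le> 1} s lam"
  unfolding feasible_def star_gauge_sublevel_set[OF assms(2)]
proof (intro conjI allI)
  fix x y
  have "f y \<le> f x + s * N (x - y)"
    using lipschitz_gauge_le[OF assms(2), of y x] is_norm_minus_commute[OF assms(1)] by metis
  also have "\<dots> \<le> s * N (x - y) + lam x" using assms(6)[of x] by simp
  finally show "ereal (f y) \<le> ereal (s * N (x - y) + lam x)" by simp
qed (use assms emeasure_sublevel_set_le_1[OF assms(1-4)] in auto)

lemma feasible_lipschitz_gauge:
  fixes K :: "'a::euclidean_space set"
  assumes N: "is_norm N" and K: "star_body K" and feas: "feasible N P K s lam"
  obtains f where "lipschitz_gauge N s f" "emeasure lborel {x. f x < 1} \<le> 1" "\<And>x. f x \<le> lam x"
proof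
  define g where "g y = real_of_ereal (star_gauge K y)" for y
  define f where "f x = (SUP y. g y - s * N (x - y))" for x
  from feas have s: "0 \<le> s" and vol: "emeasure lborel K \<le> 1"
    and le: "\<And>x y. star_gauge K y \<le> ereal (s * N (x - y) + lam x)"
    by (auto simp: feasible_def)
  have star: "star_set K" and comp: "compact K"
    using K by (auto simp: star_body_def)
  \<comment> \<open>The constraint bounds the gauge by a real number, so passing to \<open>g\<close>
    loses nothing.\<close>
  have gK: "star_gauge K y = ereal (g y)" for y
  proof -
    have "star_gauge K y \<noteq> \<infinity>" "star_gauge K y \<noteq> -\<infinity>"
      using le[of y 0] star_gauge_nonneg[of K y] by auto
    then show ?thesis unfolding g_def by (cases "star_gauge K y") auto
  qed
  have g_nonneg: "0 \<le> g y" for y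
    using star_gauge_nonneg[of K y] unfolding gK by simp
  have g_scale: "g (t *\<^sub>R y) = t * g y" if "t > 0" for t y
    using star_gauge_scaleR[OF that, of K y] unfolding gK by simp
  have g_le: "g y - s * N (x - y) \<le> lam x" for x y
    using le[of y x] unfolding gK by simp
  \<comment> \<open>With this bound, given by the constraint at \<open>x\<close>, the real supremum
    defining \<open>f x\<close> is a genuine least upper bound.\<close>
  have bdd: "bdd_above (range (\<lambda>y. g y - s * N (x - y)))" for x
    using g_le[of _ x] by (auto intro!: bdd_aboveI)
  have f_upper: "g y - s * N (x - y) \<le> f x" for x y
    unfolding f_def by (rule cSUP_upper[OF _ bdd]) simp
  have f_least: "f x \<le> c" if "\<And>y. g y - s * N (x - y) \<le> c" for x c
    unfolding f_def by (rule cSUP_least) (use that in auto)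
  have g_le_f: "g x \<le> f x" for x
    using f_upper[of x x] by (simp add: is_norm_0[OF N])
  show "f x \<le> lam x" for x
    by (rule f_least) (rule g_le)
  \<comment> \<open>Replace \<open>y\<close> by \<open>y / t\<close> in the supremum. The reverse
    inequality follows later from this one with \<open>1 / t\<close> in place of
    \<open>t\<close>.\<close>
  have f_scale_le: "f (t *\<^sub>R x) \<le> t * f x" if "t > 0" for t x
  proof (rule f_least)
    fix y
    have "t *\<^sub>R x - y = t *\<^sub>R (x - (1 / t) *\<^sub>R y)"
      using that by (simp add: algebra_simps)
    then have "N (t *\<^sub>R x - y) = t * N (x - (1 / t) *\<^sub>R y)"
      using is_norm_scaleR[OF N] that by simp
    moreover have "g y = t * g ((1 / t) *\<^sub>R y)"
      using g_scale[of "1 / t" y] that by simp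
    ultimately have "g y - s * N (t *\<^sub>R x - y) =
        t * (g ((1 / t) *\<^sub>R y) - s * N (x - (1 / t) *\<^sub>R y))"
      by (simp add: algebra_simps)
    also have "\<dots> \<le> t * f x"
      using that by (intro mult_left_mono f_upper) simp
    finally show "g y - s * N (t *\<^sub>R x - y) \<le> t * f x" .
  qed
  show "lipschitz_gauge N s f"
    unfolding lipschitz_gauge_def
  proof (intro conjI allI impI)
    show "0 \<le> f x" for x
      using g_nonneg[of x] g_le_f[of x] by simp
    show "f x \<le> f y + s * N (x - y)" for x y
    proof (rule f_least)
      fix z
      have "N (y - z) \<le> N (y - x) + N (x - z)"
        using is_norm_triangle[OF N, of "y - x" "x - z"] by simp
      then have "s * N (y - z) \<le> s * (N (x - y) + N (x - z))"
        using s by (intro mult_left_mono) (simp_all add: is_norm_minus_commute[OF N, of x y])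
      then show "g z - s * N (x - z) \<le> f y + s * N (x - y)"
        using f_upper[of z y] by (simp add: algebra_simps)
    qed
    show "f (t *\<^sub>R x) = t * f x" if "t > 0" for t x
    proof (rule antisym[OF f_scale_le[OF that]])
      have "f x \<le> (1 / t) * f (t *\<^sub>R x)"
        using f_scale_le[of "1 / t" "t *\<^sub>R x"] that by simp
      then show "t * f x \<le> f (t *\<^sub>R x)"
        using that by (simp add: field_simps)
    qed
  qed
  have "{x. f x < 1} \<subseteq> K"
  proof
    fix x assume "x \<in> {x. f x < 1}"
    then have "g x < 1" using g_le_f[of x] by simp
    then have "star_gauge K x < 1" unfolding gK by (simp add: one_ereal_def)
    then show "x \<in> K" by (rule star_gauge_less_1_imp_mem[OF star])
  qed
  then have "emeasure lborel {x. f x < 1} \<le> emeasure lborel K"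
    using comp by (intro emeasure_mono) (auto intro: borel_compact)
  with vol show "emeasure lborel {x. f x < 1} \<le> 1" by order
qed

subsection \<open>Limits\<close>

text \<open>The common Lipschitz constant \<open>M * B\<close> and the value 0 at the origin give
  equicontinuity and boundedness on the compact unit ball, as Arzela--Ascoli requires. A second
  extraction makes the constants \<open>s\<close> converge as well.\<close>

lemma lipschitz_gauge_convergent_subseq:
  fixes f :: "nat \<Rightarrow> 'a::euclidean_space \<Rightarrow> real"
  assumes N: "is_norm N" and f: "\<And>n. lipschitz_gauge N (s n) (f n)"
    and s: "\<And>n. 0 \<le> s n" "\<And>n. s n \<le> M"
  obtains r s' f' where "strict_mono r" "(s \<circ> r) \<longlonglongrightarrow> s'" "\<And>x. (\<lambda>n. f (r n) x) \<longlonglongrightarrow> f' x"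
    "lipschitz_gauge N s' f'"
proof -
  obtain B where B: "B > 0" "\<And>x. N x \<le> B * norm x"
    using is_norm_le_norm[OF N] by blast
  have M: "0 \<le> M" using s[of 0] by simp
  have lip: "norm (f n x - f n y) \<le> M * B * norm (x - y)" for n x y
  proof -
    have "norm (f n x - f n y) \<le> s n * B * norm (x - y)"
      using lipschitz_gauge_dist_le[OF N f s(1) B(2)] by simp
    also have "\<dots> \<le> M * B * norm (x - y)"
      using s B(1) by (intro mult_right_mono) auto
    finally show ?thesis .
  qed
  obtain g k where k: "strict_mono (k :: nat \<Rightarrow> nat)" and
    g: "\<And>e. 0 < e \<Longrightarrow> \<exists>m. \<forall>n x. n \<ge> m \<and> x \<in> cball 0 1 \<longrightarrow> norm (f (k n) x - g x) < e"
  proof (rule Arzela_Ascoli[of "cball (0::'a) 1" f "M * B"])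
    fix n and x :: 'a assume "x \<in> cball 0 1"
    then have "M * B * norm x \<le> M * B * 1"
      using M B(1) by (intro mult_left_mono) auto
    then show "norm (f n x) \<le> M * B"
      using lip[of n x 0] lipschitz_gauge_zero[OF f[of n]] by simp
  next
    fix x :: 'a and e :: real assume "0 < e"
    \<comment> \<open>The added 1 keeps the divisor positive when \<open>M = 0\<close>.\<close>
    have D: "0 < M * B + 1" using M B(1) by (simp add: add_nonneg_pos)
    have "norm (f n x - f n y) < e" if "norm (x - y) < e / (M * B + 1)" for n y
    proof -
      have "norm (f n x - f n y) \<le> M * B * norm (x - y)" by (rule lip)
      also have "\<dots> \<le> (M * B + 1) * norm (x - y)" by (intro mult_right_mono) auto
      also have "\<dots> < e" using that D by (simp add: field_simps)
      finally show ?thesis .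
    qed
    then show "\<exists>d. 0 < d \<and> (\<forall>n y. y \<in> cball 0 1 \<and> norm (x - y) < d \<longrightarrow> norm (f n x - f n y) < e)"
      using \<open>0 < e\<close> D by (intro exI[of _ "e / (M * B + 1)"]) auto
  qed (auto intro: that)
  have "bounded (range (s \<circ> k))"
    using s by (intro boundedI[of _ M]) auto
  then obtain s' r where r: "strict_mono (r :: nat \<Rightarrow> nat)" "((s \<circ> k) \<circ> r) \<longlonglongrightarrow> s'"
    using bounded_imp_convergent_subsequence[of "s \<circ> k"] by blast
  have conv: "convergent (\<lambda>n. f (k (r n)) x)" for x
  proof -
    \<comment> \<open>Dividing by \<open>c\<close> moves \<open>x\<close> into the unit ball, and
      \<open>c\<close> is positive even for \<open>x = 0\<close>.\<close>
    define c where "c = norm x + 1"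
    have c: "c > 0" by (simp add: c_def add_nonneg_pos)
    define z where "z = (1 / c) *\<^sub>R x"
    have z: "z \<in> cball 0 1" "x = c *\<^sub>R z"
      using c by (auto simp: z_def c_def divide_simps)
    have "(\<lambda>n. f (k n) z) \<longlonglongrightarrow> g z"
      using g z(1) unfolding LIMSEQ_iff by blast
    then have "(\<lambda>n. f (k (r n)) z) \<longlonglongrightarrow> g z"
      using LIMSEQ_subseq_LIMSEQ[OF _ r(1), of "\<lambda>n. f (k n) z"] by (simp add: o_def)
    then have "(\<lambda>n. c * f (k (r n)) z) \<longlonglongrightarrow> c * g z" by (rule tendsto_mult_left)
    then show ?thesis
      using lipschitz_gauge_scaleR[OF f c] z(2) by (auto simp: convergent_def)
  qed
  define f' where "f' x = lim (\<lambda>n. f (k (r n)) x)" for x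
  have f': "(\<lambda>n. f (k (r n)) x) \<longlonglongrightarrow> f' x" for x
    using conv[of x] unfolding f'_def by (simp add: convergent_LIMSEQ_iff)
  have s': "(\<lambda>n. s (k (r n))) \<longlonglongrightarrow> s'" using r(2) by (simp add: o_def)
  have "lipschitz_gauge N s' f'"
    unfolding lipschitz_gauge_def
  proof (intro conjI allI impI)
    show "0 \<le> f' x" for x
      by (rule LIMSEQ_le_const[OF f']) (use lipschitz_gauge_nonneg[OF f] in auto)
    show "f' x \<le> f' y + s' * N (x - y)" for x y
      by (rule LIMSEQ_le[OF f' tendsto_add[OF f' tendsto_mult_right[OF s']]])
        (use lipschitz_gauge_le[OF f] in auto)
    show "f' (t *\<^sub>R x) = t * f' x" if "t > 0" for t x
      using LIMSEQ_unique[OF f'[of "t *\<^sub>R x"]] tendsto_mult_left[OF f'[of x], of t]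
        lipschitz_gauge_scaleR[OF f that] by simp
  qed
  then show thesis
    using that[of "k \<circ> r" s' f'] k r f' by (auto simp: strict_mono_o o_assoc)
qed

text \<open>A strict inequality for the limit holds eventually along the sequence, so the indicator
  of the limit set is at most the liminf of the indicators, and Fatou's lemma applies.\<close>

lemma emeasure_strict_sublevel_limit_le:
  fixes f :: "nat \<Rightarrow> 'a \<Rightarrow> real"
  assumes "\<And>n. f n \<in> borel_measurable M" "f' \<in> borel_measurable M"
    and lim: "\<And>x. x \<in> space M \<Longrightarrow> (\<lambda>n. f n x) \<longlonglongrightarrow> f' x"
    and le: "\<And>n. emeasure M {x \<in> space M. f n x < c} \<le> b"
  shows "emeasure M {x \<in> space M. f' x < c} \<le> b"
proof -
  let ?A = "\<lambda>h::'a \<Rightarrow> real. {x \<in> space M. h x < c}"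
  have [measurable]: "?A f' \<in> sets M" "\<And>n. ?A (f n) \<in> sets M"
    using assms(1,2) by measurable
  have "emeasure M (?A f') = (\<integral>\<^sup>+x. indicator (?A f') x \<partial>M)" by simp
  also have "\<dots> \<le> (\<integral>\<^sup>+x. liminf (\<lambda>n. indicator (?A (f n)) x) \<partial>M)"
  proof (rule nn_integral_mono)
    fix x assume x: "x \<in> space M"
    show "indicator (?A f') x \<le> liminf (\<lambda>n. indicator (?A (f n)) x :: ennreal)"
    proof (cases "f' x < c")
      case True
      then have "\<forall>\<^sub>F n in sequentially. f n x < c"
        using lim[OF x] by (simp add: order_tendstoD)
      then have "\<forall>\<^sub>F n in sequentially. (1::ennreal) \<le> indicator (?A (f n)) x"
        by eventually_elim (simp add: x)
      then have "(1::ennreal) \<le> liminf (\<lambda>n. indicator (?A (f n)) x)"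
        by (rule Liminf_bounded)
      then show ?thesis using True x by simp
    qed simp
  qed
  also have "\<dots> \<le> liminf (\<lambda>n. \<integral>\<^sup>+x. indicator (?A (f n)) x \<partial>M)"
    by (rule nn_integral_liminf) measurable
  also have "\<dots> = liminf (\<lambda>n. emeasure M (?A (f n)))" by simp
  also have "\<dots> \<le> limsup (\<lambda>n. emeasure M (?A (f n)))"
    by (rule Liminf_le_Limsup) simp
  also have "\<dots> \<le> b"
    using le by (intro Limsup_bounded) auto
  finally show ?thesis .
qed

text \<open>Fatou's lemma for nonnegative functions. The bounds \<open>c n\<close> vary with
  \<open>n\<close> so that the converging cost \<open>s n * eps\<close> can be moved to the
  right-hand side.\<close>

lemma integral_limit_le:
  fixes f :: "nat \<Rightarrow> 'a \<Rightarrow> real"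
  assumes int: "\<And>n. integrable M (f n)" and meas: "f' \<in> borel_measurable M"
    and nonneg: "\<And>n x. 0 \<le> f n x"
    and lim: "\<And>x. (\<lambda>n. f n x) \<longlonglongrightarrow> f' x"
    and le: "\<And>n. integral\<^sup>L M (f n) \<le> c n" and c: "c \<longlonglongrightarrow> c'"
  shows "integrable M f'" "integral\<^sup>L M f' \<le> c'"
proof -
  have nonneg': "0 \<le> f' x" for x
    by (rule LIMSEQ_le_const[OF lim]) (use nonneg in auto)
  \<comment> \<open>\<open>ennreal\<close> truncates negative reals to 0, so signs must be known
    before returning to real integrals.\<close>
  have c_nonneg: "0 \<le> c n" for n
    using le[of n] Bochner_Integration.integral_nonneg[of M "f n"] nonneg
    by (meson order_trans)
  then have c'_nonneg: "0 \<le> c'" by (intro LIMSEQ_le_const[OF c]) auto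
  have "(\<integral>\<^sup>+x. ennreal (f' x) \<partial>M) = (\<integral>\<^sup>+x. liminf (\<lambda>n. ennreal (f n x)) \<partial>M)"
    by (intro nn_integral_cong lim_imp_Liminf[symmetric] tendsto_ennrealI lim) simp
  also have "\<dots> \<le> liminf (\<lambda>n. \<integral>\<^sup>+x. ennreal (f n x) \<partial>M)"
    by (rule nn_integral_liminf) (use int in measurable)
  also have "\<dots> = liminf (\<lambda>n. ennreal (integral\<^sup>L M (f n)))"
    using nonneg int by (simp add: nn_integral_eq_integral)
  also have "\<dots> \<le> liminf (\<lambda>n. ennreal (c n))"
    using le by (intro Liminf_mono always_eventually allI ennreal_leI)
  also have "\<dots> = ennreal c'"
    by (intro lim_imp_Liminf tendsto_ennrealI c) simp
  finally have *: "(\<integral>\<^sup>+x. ennreal (f' x) \<partial>M) \<le> ennreal c'" .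
  show int': "integrable M f'"
    by (rule integrableI_bounded[OF meas])
      (use * nonneg' in \<open>auto simp: order.strict_trans1[OF _ ennreal_less_top]\<close>)
  from * show "integral\<^sup>L M f' \<le> c'"
    using nonneg' c'_nonneg by (simp add: nn_integral_eq_integral[OF int'])
qed

subsection \<open>Existence of a minimizer\<close>

text \<open>Replacing \<open>lam\<close> by the smaller \<open>f\<close> keeps \<open>s\<close> and
  does not increase the objective; integrability follows from 0 \<open>\<le>\<close>
  \<open>f\<close> \<open>\<le>\<close> \<open>lam\<close>.\<close>

lemma minimizing_lipschitz_gauges:
  fixes P :: "'a::euclidean_space measure"
  assumes sets: "sets P = sets borel" and N: "is_norm N"
    and V: "optimal_value N P eps = ereal V" and "V < c"
  obtains s f where "0 \<le> s" "lipschitz_gauge N s f" "emeasure lborel {x. f x < 1} \<le> 1"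
    "integrable P f" "s * eps + integral\<^sup>L P f \<le> c"
proof -
  have "optimal_value N P eps < ereal c" using V \<open>V < c\<close> by simp
  then obtain K s lam where K: "star_body K" and feas: "feasible N P K s lam"
    and obj: "objective P eps s lam < c"
    unfolding optimal_value_def Inf_less_iff by auto
  have s: "0 \<le> s" and lam: "integrable P lam" using feas by (auto simp: feasible_def)
  obtain f where f: "lipschitz_gauge N s f" "emeasure lborel {x. f x < 1} \<le> 1" "\<And>x. f x \<le> lam x"
    using feasible_lipschitz_gauge[OF N K feas] by blast
  have "f \<in> borel_measurable P"
    using borel_measurable_continuous_onI[OF lipschitz_gauge_continuous[OF N f(1) s]]
      measurable_cong_sets[OF sets refl] by blast
  then have int: "integrable P f"
    by (rule Bochner_Integration.integrable_bound[OF lam])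
      (simp add: abs_le_iff abs_of_nonneg[OF lipschitz_gauge_nonneg[OF f(1)]]
        order_trans[OF f(3) abs_ge_self])
  moreover have "integral\<^sup>L P f \<le> integral\<^sup>L P lam"
    by (intro integral_mono int lam f(3))
  ultimately show thesis
    using that[OF s f(1,2)] obj by (simp add: objective_def)
qed

theorem theorem3p6:
  fixes P :: "(real ^ 'd) measure" and N :: "real ^ 'd \<Rightarrow> real" and eps :: real
  assumes "prob_space P" and "sets P = sets borel"
    and "eps > 0"
    and "is_norm N"
    and "\<bar>optimal_value N P eps\<bar> \<noteq> \<infinity>"
  shows "\<exists>K s lam. closed K \<and> star_set K \<and> feasible N P K s lam \<and>
           ereal (objective P eps s lam) = optimal_value N P eps"
proof -
  interpret prob_space P by fact
  obtain V where V: "optimal_value N P eps = ereal V"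
    using assms(5) by (cases "optimal_value N P eps") auto
  have "\<exists>s f. 0 \<le> s \<and> lipschitz_gauge N s f \<and> emeasure lborel {x. f x < 1} \<le> 1 \<and>
      integrable P f \<and> s * eps + integral\<^sup>L P f \<le> V + 1 / Suc n" for n
    by (rule minimizing_lipschitz_gauges[OF assms(2,4) V, of "V + 1 / Suc n"]) auto
  then obtain s f where s: "\<And>n. 0 \<le> s n" and f: "\<And>n. lipschitz_gauge N (s n) (f n)"
    and vol: "\<And>n. emeasure lborel {x. f n x < 1} \<le> 1" and int: "\<And>n. integrable P (f n)"
    and obj: "\<And>n. s n * eps + integral\<^sup>L P (f n) \<le> V + 1 / Suc n"
    by metis
  \<comment> \<open>The integral term is nonnegative and \<open>eps > 0\<close>, so a bounded
    objective bounds the Lipschitz constants.\<close>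
  have s_le: "s n \<le> (V + 1) / eps" for n
  proof -
    have "0 \<le> integral\<^sup>L P (f n)"
      by (intro Bochner_Integration.integral_nonneg lipschitz_gauge_nonneg[OF f])
    moreover have "1 / real (Suc n) \<le> 1" by simp
    ultimately have "s n * eps \<le> V + 1" using obj[of n] by linarith
    then show ?thesis using assms(3) by (simp add: field_simps)
  qed
  obtain r s' f' where r: "strict_mono r" and s': "(s \<circ> r) \<longlonglongrightarrow> s'"
    and lim: "\<And>x. (\<lambda>n. f (r n) x) \<longlonglongrightarrow> f' x" and f': "lipschitz_gauge N s' f'"
    by (rule lipschitz_gauge_convergent_subseq[of N s f, OF assms(4) f s s_le]) (blast intro: that)
  have s'_nonneg: "0 \<le> s'" by (rule LIMSEQ_le_const[OF s']) (use s in auto)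
  note cont = lipschitz_gauge_continuous[OF assms(4) f' s'_nonneg]
  note meas = borel_measurable_continuous_onI[OF cont]
  have "f (r n) \<in> borel_measurable lborel" for n
    using borel_measurable_continuous_onI[OF lipschitz_gauge_continuous[OF assms(4) f s]] by simp
  then have vol': "emeasure lborel {x. f' x < 1} \<le> 1"
    using emeasure_strict_sublevel_limit_le[of "\<lambda>n. f (r n)" lborel f' 1 1] meas lim vol by simp
  have c_lim: "(\<lambda>n. V + 1 / Suc (r n) - s (r n) * eps) \<longlonglongrightarrow> V + 0 - s' * eps"
    using LIMSEQ_subseq_LIMSEQ[OF LIMSEQ_Suc[OF lim_1_over_n[where ?'a = real]] r] s'
    by (intro tendsto_intros) (simp_all add: o_def)
  have measP: "f' \<in> borel_measurable P"
    using meas measurable_cong_sets[OF assms(2) refl] by blast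
  have int_n: "integral\<^sup>L P (f (r n)) \<le> V + 1 / Suc (r n) - s (r n) * eps" for n
    using obj[of "r n"] by linarith
  note limit = integral_limit_le[of P "\<lambda>n. f (r n)",
      OF int measP lipschitz_gauge_nonneg[OF f] lim int_n c_lim]
  have int': "integrable P f'" and int_le: "integral\<^sup>L P f' \<le> V + 0 - s' * eps"
    by (rule limit)+
  \<comment> \<open>\<open>c\<close> is the slack below \<open>V\<close>. The limit set may be
    unbounded and hence no star body, so its objective is not bounded below by \<open>V\<close> a
    priori. As \<open>P\<close> has mass 1, adding \<open>c\<close> to \<open>f'\<close> raises the
    objective to exactly \<open>V\<close>.\<close>
  define c where "c = V - s' * eps - integral\<^sup>L P f'"
  define lam where "lam x = f' x + c" for x
  have "0 \<le> c" using int_le by (simp add: c_def)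
  then have "feasible N P {x. f' x \<le> 1} s' lam"
    by (intro lipschitz_gauge_feasible assms(4) f' s'_nonneg vol') (auto simp: lam_def[abs_def] int')
  moreover have "objective P eps s' lam = V"
    using int' by (simp add: objective_def lam_def c_def prob_space)
  moreover have "closed {x. f' x \<le> 1}"
    by (intro closed_Collect_le cont continuous_on_const)
  ultimately show ?thesis
    using star_set_sublevel_set[OF f'] V by metis
qed

end
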